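(* Let $\mathcal{Q}$, with domain $\mathfrak{D}$, and $\mathcal{T}_t$ be the Dirichlet form and the heat semigroup, respectively, associated to a positive self-adjoint operator $A$ in $L^2(\mathbb{R}^N)$. Let $1\le q<2$ and $p=q/(q-1)$ ($p=\infty$ if $q=1$), and let $\tau>0$, $\nu>0$. For any function $v\in\mathfrak{D}\cap L^1(\mathbb{R}^N)\cap L^p(\mathbb{R}^N)$ satisfying $$\|\mathcal{T}_t(v)\|_p\le C_2\,t^{-\nu}\|v\|_q\qquad\text{for all } t>\tau,$$ there holds $$\mathcal{Q}(v,v)\ge C\,\|v\|_2^2\,\min\left\{\frac1\tau,\ \left(\frac{\|v\|_2}{\|v\|_q}\right)^{2/\nu}\right\}.$$ Here $C_2$ and $C$ denote positive constants.
   Context: $\|\cdot\|_p$ denotes the norm of $L^p(\mathbb{R}^N)$. For a positive self-adjoint operator $A$ in $L^2(\mathbb{R}^N)$, the heat semigroup is $\mathcal{T}_t=e^{-At}$ and the associated Dirichlet form is $\mathcal{Q}(f,f)=\langle Af,f\rangle$, with domain $\mathfrak{D}$; $\mathcal{Q}(f,g)$ denotes the corresponding bilinear form. As usual for Dirichlet forms, the strongly continuous symmetric semigroup $\mathcal{T}_t$ is submarkovian: $0\le f\le1$ a.e. implies $0\le\mathcal{T}_tf\le1$ a.e. *)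

theory Defs
  imports "HOL-Analysis.Analysis" "HOL-Probability.Essential_Supremum"
begin

section \<open>The real Hilbert space $L^2$ of a Euclidean space\<close>

definition L2_rel :: "('a::euclidean_space \<Rightarrow> real) \<Rightarrow> ('a \<Rightarrow> real) \<Rightarrow> bool" where
  "L2_rel f g \<longleftrightarrow>
     f \<in> borel_measurable lebesgue \<and> integrable lebesgue (\<lambda>x. (f x)\<^sup>2) \<and>
     g \<in> borel_measurable lebesgue \<and> integrable lebesgue (\<lambda>x. (g x)\<^sup>2) \<and>
     (AE x in lebesgue. f x = g x)"

lemma integrable_mult_L2:
  fixes f g :: "'a::euclidean_space \<Rightarrow> real"
  assumes [measurable]: "f \<in> borel_measurable lebesgue" "g \<in> borel_measurable lebesgue"
    and "integrable lebesgue (\<lambda>x. (f x)\<^sup>2)" "integrable lebesgue (\<lambda>x. (g x)\<^sup>2)"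
  shows "integrable lebesgue (\<lambda>x. f x * g x)"
proof (rule Bochner_Integration.integrable_bound)
  show "integrable lebesgue (\<lambda>x. (f x)\<^sup>2 + (g x)\<^sup>2)"
    using assms by simp
  have "\<bar>a * b\<bar> \<le> a\<^sup>2 + b\<^sup>2" for a b :: real
  proof -
    have "0 \<le> (\<bar>a\<bar> - \<bar>b\<bar>)\<^sup>2" by simp
    then have "2 * (\<bar>a\<bar> * \<bar>b\<bar>) \<le> a\<^sup>2 + b\<^sup>2"
      by (simp add: power2_diff)
    moreover have "0 \<le> \<bar>a\<bar> * \<bar>b\<bar>" by simp
    ultimately show ?thesis by (simp only: abs_mult)
  qed
  then show "AE x in lebesgue. norm (f x * g x) \<le> norm ((f x)\<^sup>2 + (g x)\<^sup>2)"
    by simp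
qed simp

lemma integrable_add_L2:
  fixes f g :: "'a::euclidean_space \<Rightarrow> real"
  assumes "f \<in> borel_measurable lebesgue" "g \<in> borel_measurable lebesgue"
    and "integrable lebesgue (\<lambda>x. (f x)\<^sup>2)" "integrable lebesgue (\<lambda>x. (g x)\<^sup>2)"
  shows "integrable lebesgue (\<lambda>x. (f x + g x)\<^sup>2)"
  using integrable_mult_L2[OF assms] assms(3,4) by (simp add: power2_sum mult.assoc)

quotient_type (overloaded) 'a L2 = "'a::euclidean_space \<Rightarrow> real" / partial: L2_rel
proof (rule part_equivpI)
  show "\<exists>x::'a \<Rightarrow> real. L2_rel x x"
    by (rule exI[of _ "\<lambda>_. 0"]) (simp add: L2_rel_def)
  show "symp (L2_rel :: ('a \<Rightarrow> real) \<Rightarrow> _)"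
    by (auto simp: symp_def L2_rel_def elim: AE_mp)
  show "transp (L2_rel :: ('a \<Rightarrow> real) \<Rightarrow> _)"
    unfolding transp_def L2_rel_def by (auto elim: eventually_elim2)
qed

instantiation L2 :: (euclidean_space) real_vector
begin

lift_definition zero_L2 :: "'a L2" is "\<lambda>_. 0"
  by (simp add: L2_rel_def)

lift_definition plus_L2 :: "'a L2 \<Rightarrow> 'a L2 \<Rightarrow> 'a L2" is "\<lambda>f g x. f x + g x"
  unfolding L2_rel_def by (auto intro: integrable_add_L2 elim: eventually_elim2)

lift_definition scaleR_L2 :: "real \<Rightarrow> 'a L2 \<Rightarrow> 'a L2" is "\<lambda>c f x. c * f x"
  unfolding L2_rel_def by (auto simp: power_mult_distrib elim: eventually_mono)

lift_definition uminus_L2 :: "'a L2 \<Rightarrow> 'a L2" is "\<lambda>f x. - f x"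
  unfolding L2_rel_def by (auto elim: eventually_mono)

definition minus_L2 :: "'a L2 \<Rightarrow> 'a L2 \<Rightarrow> 'a L2" where
  "minus_L2 f g = f + (- g)"

instance
proof
  fix f g h :: "'a L2" and a b :: real
  show "f + g + h = f + (g + h)"
    by transfer (auto simp: L2_rel_def add.assoc intro: integrable_add_L2)
  show "f + g = g + f"
    by transfer (auto simp: L2_rel_def add.commute intro: integrable_add_L2)
  show "0 + f = f"
    by transfer (auto simp: L2_rel_def)
  show "- f + f = 0"
    by transfer (auto simp: L2_rel_def)
  show "f - g = f + - g"
    by (rule minus_L2_def)
  show "a *\<^sub>R (f + g) = a *\<^sub>R f + a *\<^sub>R g"
    by transfer (auto simp: L2_rel_def distrib_left[symmetric] power_mult_distrib
        intro: integrable_add_L2)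
  show "(a + b) *\<^sub>R f = a *\<^sub>R f + b *\<^sub>R f"
    by transfer (auto simp: L2_rel_def distrib_right[symmetric] power_mult_distrib)
  show "a *\<^sub>R b *\<^sub>R f = (a * b) *\<^sub>R f"
    by transfer (auto simp: L2_rel_def mult.assoc power_mult_distrib)
  show "1 *\<^sub>R f = f"
    by transfer (auto simp: L2_rel_def)
qed

end

instantiation L2 :: (euclidean_space) real_inner
begin

lift_definition inner_L2 :: "'a L2 \<Rightarrow> 'a L2 \<Rightarrow> real" is
  "\<lambda>f g. LINT x|lebesgue. f x * g x"
  unfolding L2_rel_def by (auto intro!: integral_cong_AE elim: eventually_elim2)

definition norm_L2 :: "'a L2 \<Rightarrow> real" where
  "norm_L2 f = sqrt (inner f f)"

definition dist_L2 :: "'a L2 \<Rightarrow> 'a L2 \<Rightarrow> real" where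
  "dist_L2 f g = norm (f - g)"

definition sgn_L2 :: "'a L2 \<Rightarrow> 'a L2" where
  "sgn_L2 f = inverse (norm f) *\<^sub>R f"

definition uniformity_L2 :: "('a L2 \<times> 'a L2) filter" where
  "uniformity_L2 = (INF e\<in>{0<..}. principal {(f, g). dist f g < e})"

definition open_L2 :: "'a L2 set \<Rightarrow> bool" where
  "open_L2 U \<longleftrightarrow> (\<forall>f\<in>U. \<forall>\<^sub>F (f', g) in uniformity. f' = f \<longrightarrow> g \<in> U)"

instance
proof
  fix f g h :: "'a L2" and r :: real and U :: "'a L2 set"
  show "dist f g = norm (f - g)" by (rule dist_L2_def)
  show "sgn f = f /\<^sub>R norm f" by (simp add: sgn_L2_def)
  show "norm f = sqrt (inner f f)" by (rule norm_L2_def)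
  show "(uniformity :: ('a L2 \<times> 'a L2) filter) = (INF e\<in>{0<..}. principal {(x, y). dist x y < e})"
    by (rule uniformity_L2_def)
  show "open U \<longleftrightarrow> (\<forall>x\<in>U. \<forall>\<^sub>F (x', y) in uniformity. x' = x \<longrightarrow> y \<in> U)"
    by (rule open_L2_def)
  show "inner f g = inner g f"
    by transfer (simp add: mult.commute)
  show "inner (f + g) h = inner f h + inner g h"
    by transfer (auto simp: L2_rel_def distrib_right integrable_mult_L2)
  show "inner (r *\<^sub>R f) g = r * inner f g"
    by transfer (simp add: mult.assoc)
  show "0 \<le> inner f f"
    by transfer simp
  show "inner f f = 0 \<longleftrightarrow> f = 0"
    by transfer (auto simp: L2_rel_def integral_nonneg_eq_0_iff_AE power2_eq_square[symmetric])
qed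

end

section \<open>$L^p$ norms and pointwise a.e.\ properties\<close>

text \<open>The norm is \<open>\<infinity>\<close> exactly when the class does not belong to $L^p$. The exponent ranges
  over \<open>1 \<le> p \<le> \<infinity>\<close>; the library has no powers with values in \<^typ>\<open>ennreal\<close>, which
  is the reason for the case distinction on the integral.\<close>

definition Lp_norm_fun :: "ennreal \<Rightarrow> ('a::euclidean_space \<Rightarrow> real) \<Rightarrow> ennreal" where
  "Lp_norm_fun p f =
     (if p = \<infinity> then esssup lebesgue (\<lambda>x. ennreal \<bar>f x\<bar>)
      else let I = (\<integral>\<^sup>+ x. ennreal (\<bar>f x\<bar> powr enn2real p) \<partial>lebesgue)
           in if I = \<infinity> then \<infinity> else ennreal (enn2real I powr (1 / enn2real p)))"

lift_definition Lp_norm :: "ennreal \<Rightarrow> 'a::euclidean_space L2 \<Rightarrow> ennreal" is Lp_norm_fun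
proof -
  fix p :: ennreal and f g :: "'a \<Rightarrow> real"
  assume "L2_rel f g"
  then have [measurable]: "f \<in> borel_measurable lebesgue" "g \<in> borel_measurable lebesgue"
    and ae: "AE x in lebesgue. f x = g x"
    by (auto simp: L2_rel_def)
  have "esssup lebesgue (\<lambda>x. ennreal \<bar>f x\<bar>) = esssup lebesgue (\<lambda>x. ennreal \<bar>g x\<bar>)"
  proof -
    have "(AE x in lebesgue. ennreal \<bar>f x\<bar> \<le> z) \<longleftrightarrow> (AE x in lebesgue. ennreal \<bar>g x\<bar> \<le> z)" for z
      by (rule eventually_subst) (use ae in \<open>auto elim: eventually_mono\<close>)
    then show ?thesis by (simp add: esssup_eq_AE)
  qed
  moreover have "(\<integral>\<^sup>+ x. ennreal (\<bar>f x\<bar> powr r) \<partial>lebesgue)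
      = (\<integral>\<^sup>+ x. ennreal (\<bar>g x\<bar> powr r) \<partial>lebesgue)" for r
    by (rule nn_integral_cong_AE) (use ae in \<open>auto elim: eventually_mono\<close>)
  ultimately show "Lp_norm_fun p f = Lp_norm_fun p g"
    by (simp add: Lp_norm_fun_def)
qed

lift_definition L2_AE :: "(real \<Rightarrow> bool) \<Rightarrow> 'a::euclidean_space L2 \<Rightarrow> bool" is
  "\<lambda>P f. AE x in lebesgue. P (f x)"
  unfolding L2_rel_def by (auto elim: eventually_elim2)

lemma Lp_norm_2: "Lp_norm 2 f = ennreal (norm f)"
  unfolding norm_L2_def
proof (transfer, goal_cases)
  case (1 f)
  then have int: "integrable lebesgue (\<lambda>x. (f x)\<^sup>2)"
    by (simp add: L2_rel_def)
  have "(\<integral>\<^sup>+ x. ennreal (\<bar>f x\<bar> powr 2) \<partial>lebesgue) = ennreal (LINT x|lebesgue. (f x)\<^sup>2)"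
    using nn_integral_eq_integral[OF int] by (simp add: powr_numeral)
  then show ?case
    by (simp add: Lp_norm_fun_def powr_half_sqrt power2_eq_square)
qed

section \<open>Positive self-adjoint operators, semigroups and forms\<close>

text \<open>An unbounded operator is given by its domain \<open>D\<close> and a function \<open>A\<close> whose values outside
  \<open>D\<close> are irrelevant.\<close>

definition linear_operator_on :: "'h::real_vector set \<Rightarrow> ('h \<Rightarrow> 'h) \<Rightarrow> bool" where
  "linear_operator_on D A \<longleftrightarrow> subspace D \<and>
     (\<forall>f\<in>D. \<forall>g\<in>D. A (f + g) = A f + A g) \<and> (\<forall>c. \<forall>f\<in>D. A (c *\<^sub>R f) = c *\<^sub>R A f)"

definition adjoint_domain :: "'h::real_inner set \<Rightarrow> ('h \<Rightarrow> 'h) \<Rightarrow> 'h set" where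
  "adjoint_domain D A = {g. \<exists>h. \<forall>f\<in>D. inner (A f) g = inner f h}"

definition self_adjoint :: "'h::real_inner set \<Rightarrow> ('h \<Rightarrow> 'h) \<Rightarrow> bool" where
  "self_adjoint D A \<longleftrightarrow> linear_operator_on D A \<and> closure D = UNIV \<and>
     adjoint_domain D A = D \<and> (\<forall>f\<in>D. \<forall>g\<in>D. inner (A f) g = inner f (A g))"

definition positive_operator :: "'h::real_inner set \<Rightarrow> ('h \<Rightarrow> 'h) \<Rightarrow> bool" where
  "positive_operator D A \<longleftrightarrow> (\<forall>f\<in>D. 0 \<le> inner (A f) f)"

definition C0_semigroup :: "(real \<Rightarrow> 'h::real_normed_vector \<Rightarrow> 'h) \<Rightarrow> bool" where
  "C0_semigroup T \<longleftrightarrow> (\<forall>t\<ge>0. bounded_linear (T t)) \<and> T 0 = id \<and>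
     (\<forall>s\<ge>0. \<forall>t\<ge>0. T (s + t) = T s \<circ> T t) \<and>
     (\<forall>f. ((\<lambda>t. T t f) \<longlongrightarrow> f) (at_right 0))"

text \<open>\<open>T t\<close> is $e^{-At}$: the strongly continuous semigroup whose infinitesimal generator,
  including its domain, is $-A$. Such a semigroup is determined by \<open>A\<close> for \<open>t \<ge> 0\<close>.\<close>

definition heat_semigroup ::
    "'h::real_normed_vector set \<Rightarrow> ('h \<Rightarrow> 'h) \<Rightarrow> (real \<Rightarrow> 'h \<Rightarrow> 'h) \<Rightarrow> bool" where
  "heat_semigroup D A T \<longleftrightarrow> C0_semigroup T \<and>
     (\<forall>f g. ((\<lambda>t. (T t f - f) /\<^sub>R t) \<longlongrightarrow> g) (at_right 0) \<longleftrightarrow> f \<in> D \<and> g = - A f)"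

definition submarkovian :: "(real \<Rightarrow> 'a::euclidean_space L2 \<Rightarrow> 'a L2) \<Rightarrow> bool" where
  "submarkovian T \<longleftrightarrow>
     (\<forall>t\<ge>0. \<forall>f. L2_AE (\<lambda>y. 0 \<le> y \<and> y \<le> 1) f \<longrightarrow> L2_AE (\<lambda>y. 0 \<le> y \<and> y \<le> 1) (T t f))"

text \<open>The form of \<open>A\<close> is the closure of $(f,g) \mapsto \langle Af, g\rangle$, which a priori is
  defined on \<open>D\<close> only: its domain (the domain of $A^{1/2}$) consists of the limits of sequences in
  \<open>D\<close> that are Cauchy for the form, and its values are the limits along such sequences.\<close>

definition form_approx :: "'h::real_inner set \<Rightarrow> ('h \<Rightarrow> 'h) \<Rightarrow> (nat \<Rightarrow> 'h) \<Rightarrow> 'h \<Rightarrow> bool" where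
  "form_approx D A u f \<longleftrightarrow> (\<forall>n. u n \<in> D) \<and> u \<longlonglongrightarrow> f \<and>
     (\<forall>e>0. \<exists>M. \<forall>m\<ge>M. \<forall>n\<ge>M. inner (A (u m - u n)) (u m - u n) < e)"

definition form_domain :: "'h::real_inner set \<Rightarrow> ('h \<Rightarrow> 'h) \<Rightarrow> 'h set" where
  "form_domain D A = {f. \<exists>u. form_approx D A u f}"

definition dirichlet_form :: "'h::real_inner set \<Rightarrow> ('h \<Rightarrow> 'h) \<Rightarrow> 'h \<Rightarrow> 'h \<Rightarrow> real" where
  "dirichlet_form D A f g =
     (THE l. \<forall>u w. form_approx D A u f \<longrightarrow> form_approx D A w g \<longrightarrow>
        (\<lambda>n. inner (A (u n)) (w n)) \<longlonglongrightarrow> l)"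

text \<open>The form is well defined and extends $\langle Af, g\rangle$.\<close>

context
  fixes D :: "'h::real_inner set" and A :: "'h \<Rightarrow> 'h"
  assumes sa: "self_adjoint D A" and pos: "positive_operator D A"
begin

private definition N where "N f = sqrt (inner (A f) f)"

private lemma D_diff: "f \<in> D \<Longrightarrow> g \<in> D \<Longrightarrow> f - g \<in> D"
  using sa by (simp add: self_adjoint_def linear_operator_on_def subspace_diff)

private lemma D_scale: "f \<in> D \<Longrightarrow> c *\<^sub>R f \<in> D"
  using sa by (simp add: self_adjoint_def linear_operator_on_def subspace_scale)

private lemma A_scale: "f \<in> D \<Longrightarrow> A (c *\<^sub>R f) = c *\<^sub>R A f"
  using sa by (simp add: self_adjoint_def linear_operator_on_def)

private lemma A_diff:
  assumes "f \<in> D" "g \<in> D" shows "A (f - g) = A f - A g"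
proof -
  have "A (f + (-1) *\<^sub>R g) = A f + A ((-1) *\<^sub>R g)"
    using sa assms D_scale[of g "-1"] unfolding self_adjoint_def linear_operator_on_def by blast
  then show ?thesis using A_scale[OF assms(2), of "-1"] by simp
qed

private lemma A_sym: "f \<in> D \<Longrightarrow> g \<in> D \<Longrightarrow> inner (A f) g = inner (A g) f"
  using sa by (metis self_adjoint_def inner_commute)

private lemma A_pos: "f \<in> D \<Longrightarrow> 0 \<le> inner (A f) f"
  using pos by (simp add: positive_operator_def)

private lemma N_nonneg: "f \<in> D \<Longrightarrow> 0 \<le> N f"
  by (simp add: N_def A_pos)

private lemma N_sq: "f \<in> D \<Longrightarrow> (N f)\<^sup>2 = inner (A f) f"
  by (simp add: N_def A_pos)

private lemma CS:
  assumes f: "f \<in> D" and g: "g \<in> D"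
  shows "\<bar>inner (A f) g\<bar> \<le> N f * N g"
proof -
  let ?a = "inner (A f) f" and ?b = "inner (A f) g" and ?c = "inner (A g) g"
  have q: "0 \<le> ?a - 2 * x * ?b + x\<^sup>2 * ?c" for x
  proof -
    have "0 \<le> inner (A (f - x *\<^sub>R g)) (f - x *\<^sub>R g)"
      by (intro A_pos D_diff D_scale f g)
    also have "\<dots> = ?a - 2 * x * ?b + x\<^sup>2 * ?c"
      by (simp add: A_diff A_scale f g D_scale inner_diff_left inner_diff_right
          A_sym[OF g f] power2_eq_square algebra_simps)
    finally show ?thesis .
  qed
  have "?b\<^sup>2 \<le> ?a * ?c"
  proof (cases "?c = 0")
    case True
    have "?b = 0"
    proof (rule ccontr)
      assume "?b \<noteq> 0"
      then show False using q[of "(?a + 1) / (2 * ?b)"] True by (simp add: field_simps)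
    qed
    then show ?thesis using A_pos f g by simp
  next
    case False
    then have "0 < ?c" using A_pos[OF g] by simp
    then show ?thesis using q[of "?b / ?c"]
      by (simp add: field_simps power2_eq_square)
  qed
  then have "sqrt (?b\<^sup>2) \<le> sqrt (?a * ?c)" by (rule real_sqrt_le_mono)
  then show ?thesis by (simp add: N_def real_sqrt_mult)
qed

private lemma N_triangle:
  assumes f: "f \<in> D" and g: "g \<in> D"
  shows "N (f - g) \<le> N f + N g"
proof (rule power2_le_imp_le)
  have "(N (f - g))\<^sup>2 = (N f)\<^sup>2 - 2 * inner (A f) g + (N g)\<^sup>2"
    by (simp add: N_sq D_diff f g A_diff inner_diff_left inner_diff_right A_sym[OF g f])
  also have "\<dots> \<le> (N f + N g)\<^sup>2"
    using CS[OF f g] by (simp add: power2_sum)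
  finally show "(N (f - g))\<^sup>2 \<le> (N f + N g)\<^sup>2" .
qed (simp add: N_nonneg f g)

private lemma N_Cauchy:
  assumes "form_approx D A u f" "0 < e"
  shows "\<exists>M. \<forall>m\<ge>M. \<forall>n\<ge>M. N (u m - u n) < e"
proof -
  obtain M where M: "\<And>m n. m \<ge> M \<Longrightarrow> n \<ge> M \<Longrightarrow> inner (A (u m - u n)) (u m - u n) < e\<^sup>2"
    using assms unfolding form_approx_def by (metis zero_less_power)
  have "N (u m - u n) < e" if "m \<ge> M" "n \<ge> M" for m n
    using real_sqrt_less_mono[OF M[OF that]] assms(2) by (simp add: N_def)
  then show ?thesis by blast
qed

private lemma N_bounded:
  assumes u: "form_approx D A u f"
  shows "\<exists>K>0. \<exists>M. \<forall>n\<ge>M. N (u n) \<le> K"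
proof -
  have uD: "u n \<in> D" for n using u by (simp add: form_approx_def)
  obtain M where M: "\<And>m n. m \<ge> M \<Longrightarrow> n \<ge> M \<Longrightarrow> N (u m - u n) < 1"
    using N_Cauchy[OF u, of 1] by auto
  have "N (u n) \<le> N (u M) + 1" if "n \<ge> M" for n
  proof -
    have "N (- u M) = N (u M)"
      using A_scale[OF uD, of "-1" M] by (simp add: N_def)
    then show ?thesis
      using N_triangle[OF D_diff[OF uD uD, of n M] D_scale[OF uD, of "-1" M]] M[OF that, of M]
      by simp
  qed
  then show ?thesis using N_nonneg[OF uD, of M]
    by (intro exI[of _ "N (u M) + 1"]) auto
qed

private lemma form_approx_diff:
  assumes u: "form_approx D A u f" and w: "form_approx D A w g"
  shows "form_approx D A (\<lambda>n. u n - w n) (f - g)"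
  unfolding form_approx_def
proof (intro conjI allI impI)
  have D: "u n \<in> D" "w n \<in> D" for n using u w by (auto simp: form_approx_def)
  show "u n - w n \<in> D" for n by (intro D_diff D)
  show "(\<lambda>n. u n - w n) \<longlonglongrightarrow> f - g"
    using u w by (auto simp: form_approx_def intro: tendsto_diff)
  fix e :: real assume e: "0 < e"
  obtain M1 where M1: "\<And>m n. m \<ge> M1 \<Longrightarrow> n \<ge> M1 \<Longrightarrow> N (u m - u n) < sqrt e / 2"
    using N_Cauchy[OF u, of "sqrt e / 2"] e by auto
  obtain M2 where M2: "\<And>m n. m \<ge> M2 \<Longrightarrow> n \<ge> M2 \<Longrightarrow> N (w m - w n) < sqrt e / 2"
    using N_Cauchy[OF w, of "sqrt e / 2"] e by auto
  show "\<exists>M. \<forall>m\<ge>M. \<forall>n\<ge>M. inner (A (u m - w m - (u n - w n))) (u m - w m - (u n - w n)) < e"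
  proof (intro exI allI impI)
    fix m n assume mn: "m \<ge> max M1 M2" "n \<ge> max M1 M2"
    have eq: "u m - w m - (u n - w n) = (u m - u n) - (w m - w n)" by simp
    have "N ((u m - u n) - (w m - w n)) < sqrt e"
      using N_triangle[OF D_diff[OF D(1) D(1), of m n] D_diff[OF D(2) D(2), of m n]]
        M1[of m n] M2[of m n] mn by simp
    then show "inner (A (u m - w m - (u n - w n))) (u m - w m - (u n - w n)) < e"
      unfolding eq N_def by simp
  qed
qed

private lemma N_null:
  assumes z: "form_approx D A z 0"
  shows "(\<lambda>n. N (z n)) \<longlonglongrightarrow> 0"
proof (rule LIMSEQ_I)
  have zD: "z n \<in> D" for n using z by (simp add: form_approx_def)
  fix r :: real assume r: "0 < r"
  obtain K M1 where K: "K > 0" and M1: "\<And>n. n \<ge> M1 \<Longrightarrow> N (z n) \<le> K"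
    using N_bounded[OF z] by blast
  have "0 < r\<^sup>2 / (2 * K)" using r K by simp
  then obtain M2 where M2: "\<And>m n. m \<ge> M2 \<Longrightarrow> n \<ge> M2 \<Longrightarrow> N (z m - z n) < r\<^sup>2 / (2 * K)"
    using N_Cauchy[OF z] by blast
  have "norm (N (z n) - 0) < r" if n: "n \<ge> max M1 M2" for n
  proof -
    have "(\<lambda>m. inner (A (z n)) (z m)) \<longlonglongrightarrow> inner (A (z n)) 0"
      using z by (intro tendsto_intros) (auto simp: form_approx_def)
    then have lim: "(\<lambda>m. r\<^sup>2 / 2 + inner (A (z n)) (z m)) \<longlonglongrightarrow> r\<^sup>2 / 2"
      using tendsto_add[OF tendsto_const] by fastforce
    have "(N (z n))\<^sup>2 \<le> r\<^sup>2 / 2 + inner (A (z n)) (z m)" if m: "m \<ge> M2" for m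
    proof -
      have "(N (z n))\<^sup>2 = inner (A (z n)) (z n - z m) + inner (A (z n)) (z m)"
        by (simp add: N_sq zD inner_diff_right)
      also have "inner (A (z n)) (z n - z m) \<le> N (z n) * N (z n - z m)"
        using CS[OF zD D_diff[OF zD zD], of n n m] by simp
      also have "\<dots> \<le> K * (r\<^sup>2 / (2 * K))"
        using M1[of n] M2[of n m] n m K
        by (intro mult_mono) (auto simp: N_nonneg zD D_diff)
      also have "\<dots> = r\<^sup>2 / 2" using K by simp
      finally show ?thesis by simp
    qed
    then have "(N (z n))\<^sup>2 \<le> r\<^sup>2 / 2"
      by (intro tendsto_lowerbound[OF lim]) (auto simp: eventually_sequentially)
    also have "\<dots> < r\<^sup>2" using r by simp
    finally have "N (z n) < r" using r by (intro power_less_imp_less_base[of _ 2 r]) auto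
    then show ?thesis by (simp add: N_nonneg zD)
  qed
  then show "\<exists>no. \<forall>n\<ge>no. norm (N (z n) - 0) < r" by blast
qed

private lemma form_convergent:
  assumes u: "form_approx D A u f" and w: "form_approx D A w g"
  shows "convergent (\<lambda>n. inner (A (u n)) (w n))"
proof (rule Cauchy_convergent, rule metric_CauchyI)
  have D: "u n \<in> D" "w n \<in> D" for n using u w by (auto simp: form_approx_def)
  fix e :: real assume e: "0 < e"
  obtain K M1 where K: "K > 0" and M1: "\<And>n. n \<ge> M1 \<Longrightarrow> N (u n) \<le> K"
    using N_bounded[OF u] by blast
  obtain L M2 where L: "L > 0" and M2: "\<And>n. n \<ge> M2 \<Longrightarrow> N (w n) \<le> L"
    using N_bounded[OF w] by blast
  have "0 < e / (2 * L)" "0 < e / (2 * K)" using e K L by auto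
  then obtain M3 M4 where
    M3: "\<And>m n. m \<ge> M3 \<Longrightarrow> n \<ge> M3 \<Longrightarrow> N (u m - u n) < e / (2 * L)" and
    M4: "\<And>m n. m \<ge> M4 \<Longrightarrow> n \<ge> M4 \<Longrightarrow> N (w m - w n) < e / (2 * K)"
    using N_Cauchy[OF u] N_Cauchy[OF w] by meson
  have "dist (inner (A (u m)) (w m)) (inner (A (u n)) (w n)) < e"
    if mn: "m \<ge> Max {M1, M2, M3, M4}" "n \<ge> Max {M1, M2, M3, M4}" for m n
  proof -
    have "inner (A (u m)) (w m) - inner (A (u n)) (w n)
        = inner (A (u m - u n)) (w m) + inner (A (u n)) (w m - w n)"
      by (simp add: A_diff D inner_diff_left inner_diff_right)
    moreover have "\<bar>inner (A (u m - u n)) (w m)\<bar> < e / 2"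
    proof -
      have "\<bar>inner (A (u m - u n)) (w m)\<bar> \<le> N (u m - u n) * N (w m)"
        by (intro CS D_diff D)
      also have "\<dots> \<le> N (u m - u n) * L"
        using M2[of m] mn by (intro mult_left_mono) (auto simp: N_nonneg D D_diff)
      also have "\<dots> < e / (2 * L) * L"
        using M3[of m n] mn L by (intro mult_strict_right_mono) auto
      finally show ?thesis using L by simp
    qed
    moreover have "\<bar>inner (A (u n)) (w m - w n)\<bar> < e / 2"
    proof -
      have "\<bar>inner (A (u n)) (w m - w n)\<bar> \<le> N (u n) * N (w m - w n)"
        by (intro CS D_diff D)
      also have "\<dots> \<le> K * N (w m - w n)"
        using M1[of n] mn by (intro mult_right_mono) (auto simp: N_nonneg D D_diff)
      also have "\<dots> < K * (e / (2 * K))"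
        using M4[of m n] mn K by (intro mult_strict_left_mono) auto
      finally show ?thesis using K by simp
    qed
    ultimately show ?thesis by (simp add: dist_real_def)
  qed
  then show "\<exists>M. \<forall>m\<ge>M. \<forall>n\<ge>M. dist (inner (A (u m)) (w m)) (inner (A (u n)) (w n)) < e"
    by blast
qed

private lemma form_independent:
  assumes u: "form_approx D A u f" "form_approx D A u' f"
    and w: "form_approx D A w g" "form_approx D A w' g"
    and lim: "(\<lambda>n. inner (A (u n)) (w n)) \<longlonglongrightarrow> l"
  shows "(\<lambda>n. inner (A (u' n)) (w' n)) \<longlonglongrightarrow> l"
proof -
  have D: "u n \<in> D" "u' n \<in> D" "w n \<in> D" "w' n \<in> D" for n
    using u w by (auto simp: form_approx_def)
  obtain K M1 where M1: "\<And>n. n \<ge> M1 \<Longrightarrow> N (w n) \<le> K"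
    using N_bounded[OF w(1)] by blast
  obtain L M2 where M2: "\<And>n. n \<ge> M2 \<Longrightarrow> N (u' n) \<le> L"
    using N_bounded[OF u(2)] by blast
  have nu: "(\<lambda>n. N (u n - u' n)) \<longlonglongrightarrow> 0" and nw: "(\<lambda>n. N (w n - w' n)) \<longlonglongrightarrow> 0"
    using N_null form_approx_diff[OF u] form_approx_diff[OF w] by simp_all
  have "(\<lambda>n. inner (A (u n)) (w n) - inner (A (u' n)) (w' n)) \<longlonglongrightarrow> 0"
  proof (rule Lim_null_comparison)
    show "(\<lambda>n. N (u n - u' n) * K + L * N (w n - w' n)) \<longlonglongrightarrow> 0"
      using tendsto_add[OF tendsto_mult[OF nu tendsto_const[of K]]
          tendsto_mult[OF tendsto_const[of L] nw]] by simp
    have "norm (inner (A (u n)) (w n) - inner (A (u' n)) (w' n))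
        \<le> N (u n - u' n) * K + L * N (w n - w' n)" if n: "n \<ge> max M1 M2" for n
    proof -
      have "inner (A (u n)) (w n) - inner (A (u' n)) (w' n)
          = inner (A (u n - u' n)) (w n) + inner (A (u' n)) (w n - w' n)"
        by (simp add: A_diff D inner_diff_left inner_diff_right)
      moreover have "\<bar>inner (A (u n - u' n)) (w n)\<bar> \<le> N (u n - u' n) * K"
        using CS[OF D_diff[OF D(1,2)] D(3), of n n n] M1[of n] n
          mult_left_mono[of "N (w n)" K "N (u n - u' n)"]
        by (auto simp: N_nonneg D D_diff)
      moreover have "\<bar>inner (A (u' n)) (w n - w' n)\<bar> \<le> L * N (w n - w' n)"
        using CS[OF D(2) D_diff[OF D(3,4)], of n n n] M2[of n] n
          mult_right_mono[of "N (u' n)" L "N (w n - w' n)"]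
        by (auto simp: N_nonneg D D_diff)
      ultimately show ?thesis by simp
    qed
    then show "\<forall>\<^sub>F n in sequentially. norm (inner (A (u n)) (w n) - inner (A (u' n)) (w' n))
        \<le> N (u n - u' n) * K + L * N (w n - w' n)"
      unfolding eventually_sequentially by blast
  qed
  from tendsto_diff[OF lim this] show ?thesis by simp
qed

lemma dirichlet_form_tendsto:
  assumes u: "form_approx D A u f" and w: "form_approx D A w g"
  shows "(\<lambda>n. inner (A (u n)) (w n)) \<longlonglongrightarrow> dirichlet_form D A f g"
proof -
  obtain l where l: "(\<lambda>n. inner (A (u n)) (w n)) \<longlonglongrightarrow> l"
    using form_convergent[OF u w] by (auto simp: convergent_def)
  have "dirichlet_form D A f g = l"
    unfolding dirichlet_form_def
  proof (rule the_equality)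
    show "\<forall>u w. form_approx D A u f \<longrightarrow> form_approx D A w g \<longrightarrow>
        (\<lambda>n. inner (A (u n)) (w n)) \<longlonglongrightarrow> l"
      using form_independent[OF u _ w _ l] by blast
  qed (use LIMSEQ_unique[OF _ l] u w in blast)
  with l show ?thesis by simp
qed

private lemma form_approx_const:
  assumes "f \<in> D" shows "form_approx D A (\<lambda>_. f) f"
  using assms A_diff[OF assms assms] by (simp add: form_approx_def)

lemma D_subset_form_domain: "D \<subseteq> form_domain D A"
  using form_approx_const by (auto simp: form_domain_def)

lemma dirichlet_form_eq_inner:
  assumes "f \<in> D" "g \<in> D"
  shows "dirichlet_form D A f g = inner (A f) g"
  using dirichlet_form_tendsto[OF form_approx_const form_approx_const, OF assms]
  by (simp add: LIMSEQ_const_iff)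

end

end

theory Submission
  imports Defs
begin

text \<open>
  Halving \<open>t\<close> increases the difference quotient $\langle f - T_t f, f\rangle / t$, since
  $\langle T_t f, f\rangle = \|T_{t/2} f\|_2^2$ and $\|f - T_{t/2} f\|_2^2 \ge 0$, and the quotient tends to $\langle Af, f\rangle$ as
  \<open>t\<close> goes to 0; hence $\langle v - T_t v, v\rangle \le t\,Q(v,v)$. By Hoelder's inequality and the
  decay assumption $\langle T_t v, v\rangle \le C_2 t^{-\nu} \|v\|_q^2$ for $t > \tau$, and it remains to
  choose $t > \tau$ such that this is at most $\|v\|_2^2 / 2$.

  The symmetry of $T_t$ is derived from that of its generator without the spectral theorem, by
  comparing $\langle T_{kh} f, T_{t-kh} g\rangle$ for successive $k$. This needs $T_s$ to be bounded
  uniformly on compact intervals, for which the completeness of $L^2$ is used.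
\<close>

section \<open>Completeness of $L^2$ (Riesz-Fischer)\<close>

lemma rep_L2:
  "rep_L2 f \<in> borel_measurable lebesgue" "integrable lebesgue (\<lambda>x. (rep_L2 f x)\<^sup>2)"
  using Quotient_rep_reflp[OF Quotient_L2, of f] by (auto simp: L2_rel_def)

lemma abs_L2_rep_L2: "abs_L2 (rep_L2 f) = f"
  by (rule Quotient_abs_rep[OF Quotient_L2])

text \<open>Expresses distances through the nonnegative integral, the form to which Fatou's lemma
  applies in the completeness proof.\<close>

lemma norm_diff_L2:
  assumes "L2_rel f f" "L2_rel g g"
  shows "(\<integral>\<^sup>+x. ennreal ((f x - g x)\<^sup>2) \<partial>lebesgue) = ennreal ((norm (abs_L2 f - abs_L2 g))\<^sup>2)"
proof -
  have m: "L2_rel (\<lambda>x. - g x) (\<lambda>x. - g x)"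
    using assms(2) by (auto simp: L2_rel_def)
  have d: "L2_rel (\<lambda>x. f x + - g x) (\<lambda>x. f x + - g x)"
    using assms(1) m by (auto simp: L2_rel_def intro: integrable_add_L2[of f "\<lambda>x. - g x", simplified])
  have "abs_L2 f - abs_L2 g = abs_L2 (\<lambda>x. f x + - g x)"
    unfolding minus_L2_def using assms m by (simp add: uminus_L2.abs_eq plus_L2.abs_eq)
  then have "(norm (abs_L2 f - abs_L2 g))\<^sup>2 = (LINT x|lebesgue. (f x - g x)\<^sup>2)"
    using inner_L2.abs_eq[OF d d] by (simp add: power2_norm_eq_inner) (simp add: power2_eq_square)
  then show ?thesis
    using d by (simp add: nn_integral_eq_integral L2_rel_def)
qed

text \<open>The index \<open>r k\<close> is chosen recursively beyond both its predecessor and the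
  Cauchy threshold for \<open>e k\<close>.\<close>

lemma Cauchy_fast_subseq:
  fixes X :: "nat \<Rightarrow> 'a::metric_space"
  assumes "Cauchy X" and "\<And>k::nat. 0 < e k"
  shows "\<exists>r. strict_mono r \<and> (\<forall>k. \<forall>m\<ge>r k. dist (X m) (X (r k)) < e k)"
proof -
  have "\<exists>N. \<forall>m\<ge>N. \<forall>n\<ge>N. dist (X m) (X n) < e k" for k
    using metric_CauchyD[OF assms(1) assms(2)] by blast
  then obtain N where N: "\<And>k m n. m \<ge> N k \<Longrightarrow> n \<ge> N k \<Longrightarrow> dist (X m) (X n) < e k" by metis
  define r where "r = rec_nat (N 0) (\<lambda>k i. max (Suc i) (N (Suc k)))"
  have r: "r 0 = N 0" "\<And>k. r (Suc k) = max (Suc (r k)) (N (Suc k))" by (simp_all add: r_def)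
  have "strict_mono r" by (rule strict_monoI_Suc) (simp add: r)
  moreover have "N k \<le> r k" for k by (cases k) (auto simp: r)
  ultimately show ?thesis using N by (intro exI[of _ r]) (meson order_trans)
qed

text \<open>A subsequence with geometrically decreasing distances converges almost everywhere.
  Fatou's lemma turns this into $L^2$ convergence of the subsequence, and a Cauchy sequence
  converges along with any of its subsequences.\<close>

instance L2 :: (euclidean_space) banach
proof
  fix X :: "nat \<Rightarrow> 'a L2"
  assume X: "Cauchy X"
  obtain r where r: "strict_mono r" and
    fast: "\<And>k m. m \<ge> r k \<Longrightarrow> dist (X m) (X (r k)) < (1/2)^k"
    using Cauchy_fast_subseq[OF X, of "\<lambda>k. (1/2)^k"] by auto
  define f where "f k = rep_L2 (X (r k))" for k
  have [measurable]: "f k \<in> borel_measurable lebesgue" for k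
    by (simp add: f_def rep_L2)
  have rel: "L2_rel (f k) (f k)" for k
    by (simp add: f_def rep_L2 L2_rel_def)
  have f_dist: "(\<integral>\<^sup>+x. ennreal ((f j x - f k x)\<^sup>2) \<partial>lebesgue) = ennreal ((dist (X (r j)) (X (r k)))\<^sup>2)" for j k
    using norm_diff_L2[OF rel rel, of j k] by (simp add: f_def abs_L2_rep_L2 dist_norm)
  have f_fast: "(\<integral>\<^sup>+x. ennreal ((f j x - f k x)\<^sup>2) \<partial>lebesgue) \<le> ennreal ((1/4)^k)" if "j \<ge> k" for j k
  proof -
    have "(dist (X (r j)) (X (r k)))\<^sup>2 \<le> ((1/2)^k)\<^sup>2"
      by (intro power_mono less_imp_le[OF fast] zero_le_dist) (simp add: that r strict_mono_less_eq)
    also have "\<dots> = (1/4)^k" by (simp add: power2_eq_square flip: power_mult_distrib)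
    finally show ?thesis by (simp only: f_dist ennreal_leI)
  qed
  have "AE x in lebesgue. convergent (\<lambda>k. f k x)"
  proof -
    \<comment> \<open>Finiteness of \<open>H x\<close> makes the increments summable, as $b \le a + b^2/a$ for $a = (2/3)^k$.\<close>
    define H where "H x = (\<Sum>k. ennreal ((3/2)^k * (f (Suc k) x - f k x)\<^sup>2))" for x
    have "(\<integral>\<^sup>+x. H x \<partial>lebesgue) = (\<Sum>k. \<integral>\<^sup>+x. ennreal ((3/2)^k * (f (Suc k) x - f k x)\<^sup>2) \<partial>lebesgue)"
      unfolding H_def by (rule nn_integral_suminf) simp
    \<comment> \<open>The ratio is 3/8 = (3/2)(1/4): the weight \<open>(3/2)^k\<close> grows slowly
      enough for the squared distances to keep the series finite.\<close>
    also have "\<dots> \<le> (\<Sum>k. ennreal ((3/8)^k))"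
    proof (intro suminf_le)
      fix k
      have "(\<integral>\<^sup>+x. ennreal ((3/2)^k * (f (Suc k) x - f k x)\<^sup>2) \<partial>lebesgue)
          = ennreal ((3/2)^k) * (\<integral>\<^sup>+x. ennreal ((f (Suc k) x - f k x)\<^sup>2) \<partial>lebesgue)"
        by (simp add: ennreal_mult nn_integral_cmult)
      also have "\<dots> \<le> ennreal ((3/2)^k) * ennreal ((1/4)^k)"
        by (intro mult_left_mono f_fast) auto
      also have "\<dots> = ennreal ((3/8)^k)" by (simp flip: ennreal_mult power_mult_distrib)
      finally show "(\<integral>\<^sup>+x. ennreal ((3/2)^k * (f (Suc k) x - f k x)\<^sup>2) \<partial>lebesgue) \<le> ennreal ((3/8)^k)" .
    qed auto
    also have "\<dots> = ennreal (\<Sum>k. (3/8)^k)" by (intro suminf_ennreal2) auto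
    finally have "(\<integral>\<^sup>+x. H x \<partial>lebesgue) \<noteq> \<infinity>" by (auto simp: top_unique)
    moreover have "H \<in> borel_measurable lebesgue" unfolding H_def by measurable
    ultimately have "AE x in lebesgue. H x \<noteq> \<infinity>"
      by (intro nn_integral_PInf_AE)
    then show ?thesis
    proof eventually_elim
      fix x assume "H x \<noteq> \<infinity>"
      then have "summable (\<lambda>k. (3/2)^k * (f (Suc k) x - f k x)\<^sup>2)"
        unfolding H_def by (intro summable_suminf_not_top) auto
      moreover have "summable (\<lambda>k. (2/3)^k :: real)" by (rule summable_geometric) auto
      ultimately have "summable (\<lambda>k. (2/3)^k + (3/2)^k * (f (Suc k) x - f k x)\<^sup>2)"
        by (intro summable_add)
      then have "summable (\<lambda>k. f (Suc k) x - f k x)"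
      proof (rule summable_comparison_test'[where N = 0])
        fix k
        define a b :: real where "a = (2/3)^k" and "b = \<bar>f (Suc k) x - f k x\<bar>"
        have a: "a > 0" "(3/2)^k = 1 / a" by (auto simp: a_def power_divide)
        have "0 \<le> (a - b)\<^sup>2 + a * b" using a by (simp add: b_def)
        then have "b * a \<le> a * a + b\<^sup>2" by (simp add: power2_eq_square algebra_simps)
        then have "b \<le> a + b\<^sup>2 / a" using a by (simp add: field_simps power2_eq_square)
        then show "norm (f (Suc k) x - f k x) \<le> (2/3)^k + (3/2)^k * (f (Suc k) x - f k x)\<^sup>2"
          using a by (simp add: a_def b_def)
      qed
      then have "convergent (\<lambda>n. \<Sum>k<n. f (Suc k) x - f k x)"
        by (simp add: summable_iff_convergent)
      then have "convergent (\<lambda>n. f n x - f 0 x)" by (simp only: sum_lessThan_telescope[of "\<lambda>k. f k x"])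
      then show "convergent (\<lambda>k. f k x)"
        using convergent_add[OF _ convergent_const[of "f 0 x"]] by fastforce
    qed
  qed
  then have lim: "AE x in lebesgue. (\<lambda>k. f k x) \<longlonglongrightarrow> lim (\<lambda>k. f k x)"
    by (simp add: convergent_LIMSEQ_iff)
  \<comment> \<open>Where the sequence diverges the value of \<open>lim\<close> is arbitrary; this
    happens only on a null set.\<close>
  define F where "F x = lim (\<lambda>k. f k x)" for x
  have F[measurable]: "F \<in> borel_measurable lebesgue"
    unfolding F_def by measurable
  have fatou: "(\<integral>\<^sup>+x. ennreal ((F x - f k x)\<^sup>2) \<partial>lebesgue) \<le> ennreal ((1/4)^k)" for k
  proof -
    have "(\<integral>\<^sup>+x. ennreal ((F x - f k x)\<^sup>2) \<partial>lebesgue)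
        = (\<integral>\<^sup>+x. liminf (\<lambda>j. ennreal ((f j x - f k x)\<^sup>2)) \<partial>lebesgue)"
    proof (rule nn_integral_cong_AE, use lim in eventually_elim)
      fix x assume "(\<lambda>k. f k x) \<longlonglongrightarrow> lim (\<lambda>k. f k x)"
      then have "(\<lambda>j. ennreal ((f j x - f k x)\<^sup>2)) \<longlonglongrightarrow> ennreal ((F x - f k x)\<^sup>2)"
        unfolding F_def by (intro tendsto_intros tendsto_ennrealI)
      then show "ennreal ((F x - f k x)\<^sup>2) = liminf (\<lambda>j. ennreal ((f j x - f k x)\<^sup>2))"
        by (simp only: lim_imp_Liminf[OF sequentially_bot])
    qed
    also have "\<dots> \<le> liminf (\<lambda>j. \<integral>\<^sup>+x. ennreal ((f j x - f k x)\<^sup>2) \<partial>lebesgue)"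
      by (rule nn_integral_liminf) simp
    \<comment> \<open>The estimate \<open>f_fast\<close> needs \<open>j \<ge> k\<close>, so it holds
      only eventually in \<open>j\<close>, which is enough to bound the limsup.\<close>
    also have "\<dots> \<le> limsup (\<lambda>j. \<integral>\<^sup>+x. ennreal ((f j x - f k x)\<^sup>2) \<partial>lebesgue)"
      by (rule Liminf_le_Limsup) simp
    also have "\<dots> \<le> ennreal ((1/4)^k)"
      by (rule Limsup_bounded) (use f_fast in \<open>auto simp: eventually_sequentially\<close>)
    finally show ?thesis .
  qed
  \<comment> \<open>\<open>F\<close> is square integrable as the sum of \<open>F - f 0\<close>,
    controlled by the case \<open>k = 0\<close> of \<open>fatou\<close>, and
    \<open>f 0\<close>.\<close>
  have "integrable lebesgue (\<lambda>x. (F x - f 0 x)\<^sup>2)"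
    using fatou[of 0] by (intro integrableI_bounded) (auto simp: le_less_trans)
  then have "integrable lebesgue (\<lambda>x. (F x - f 0 x + f 0 x)\<^sup>2)"
    using rel[of 0] by (intro integrable_add_L2) (auto simp: L2_rel_def)
  then have relF: "L2_rel F F" by (simp add: L2_rel_def)
  have "dist (X (r k)) (abs_L2 F) \<le> (1/2)^k" for k
  proof -
    have "ennreal ((dist (abs_L2 F) (X (r k)))\<^sup>2) \<le> ennreal ((1/4)^k)"
      using fatou[of k] norm_diff_L2[OF relF rel, of k] by (simp add: f_def abs_L2_rep_L2 dist_norm)
    also have "(1/4 :: real)^k = ((1/2)^k)\<^sup>2" by (simp add: power2_eq_square flip: power_mult_distrib)
    finally show ?thesis by (simp add: dist_commute)
  qed
  moreover have "(\<lambda>k. (1/2)^k :: real) \<longlonglongrightarrow> 0" by (rule LIMSEQ_power_zero) auto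
  ultimately have "(X \<circ> r) \<longlonglongrightarrow> abs_L2 F"
    unfolding tendsto_dist_iff[of "X \<circ> r"]
    by (intro Lim_null_comparison[of "\<lambda>k. dist ((X \<circ> r) k) (abs_L2 F)" "\<lambda>k. (1/2)^k"]
        always_eventually allI) simp_all
  then show "convergent X"
    using Cauchy_converges_subseq[OF X r] by (auto simp: convergent_def)
qed

section \<open>Local boundedness of strongly continuous semigroups\<close>

text \<open>Banach-Steinhaus: the closed sets \<open>E n\<close> cover the complete space, so by
  Baire's theorem one of them contains a ball. Linearity carries the bound on that ball to the whole
  space.\<close>

lemma uniform_boundedness:
  fixes F :: "('a::banach \<Rightarrow> 'b::real_normed_vector) set"
  assumes lin: "\<And>f. f \<in> F \<Longrightarrow> bounded_linear f"
    and bdd: "\<And>x. bounded ((\<lambda>f. f x) ` F)"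
  shows "\<exists>M. \<forall>f\<in>F. \<forall>x. norm (f x) \<le> M * norm x"
proof -
  define E where "E n = {x. \<forall>f\<in>F. norm (f x) \<le> real n}" for n
  have closed: "closed (E n)" for n
  proof -
    have "E n = (\<Inter>f\<in>F. {x. norm (f x) \<le> real n})" by (auto simp: E_def)
    then show ?thesis
      by (simp, intro closed_INT ballI closed_Collect_le continuous_on_norm[OF linear_continuous_on]
          continuous_on_const lin)
  qed
  have "(\<Union>n. E n) = UNIV"
  proof -
    have "\<exists>n. x \<in> E n" for x
    proof -
      obtain B where B: "\<And>f. f \<in> F \<Longrightarrow> norm (f x) \<le> B"
        using bdd[of x] by (auto simp: bounded_iff)
      obtain n where "B \<le> real n" using real_arch_simple by blast
      then show ?thesis using B by (auto simp: E_def intro: order_trans)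
    qed
    then show ?thesis by auto
  qed
  moreover have "interior (\<Union>n. E n) = {}" if "\<And>n. interior (E n) = {}"
    using Baire_category_alt[of euclidean "range E"] that closed
    by (auto simp: completely_metrizable_space_euclidean)
  ultimately obtain n x where "x \<in> interior (E n)" by fastforce
  then obtain e where e: "e > 0" "cball x e \<subseteq> E n"
    by (auto simp: mem_interior_cball)
  have "norm (f y) \<le> 2 * real n / e * norm y" if f: "f \<in> F" for f y
  proof (cases "y = 0")
    case True
    then show ?thesis using linear_0[OF bounded_linear.linear[OF lin[OF f]]] by simp
  next
    case False
    interpret bounded_linear f by (rule lin[OF f])
    \<comment> \<open>Rescaled to norm \<open>e\<close>, the vector \<open>z\<close> keeps
      \<open>x + z\<close> in the ball, and \<open>f z\<close> is a difference of two values of norm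
      at most \<open>n\<close>.\<close>
    define z where "z = (e / norm y) *\<^sub>R y"
    have "x + z \<in> cball x e" "x \<in> cball x e" using e False by (auto simp: z_def dist_norm)
    then have "x + z \<in> E n" "x \<in> E n" using e(2) by blast+
    then have "norm (f (x + z)) \<le> n" "norm (f x) \<le> n"
      using f by (auto simp: E_def)
    then have "norm (f z) \<le> 2 * n"
      using norm_triangle_ineq4[of "f (x + z)" "f x"] by (simp add: add)
    moreover have "norm (f z) = e / norm y * norm (f y)" using e by (simp add: z_def scaleR)
    ultimately show ?thesis using e False by (simp add: field_simps)
  qed
  then show ?thesis by blast
qed

text \<open>Strong continuity bounds each orbit near 0, but on an interval depending on the vector.
  Uniform boundedness along a null sequence of times gives one common interval
  \<open>[0, d]\<close>, and the semigroup law extends the bound to \<open>[0, t]\<close> in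
  finitely many steps of length \<open>d\<close>.\<close>

lemma C0_semigroup_locally_bounded:
  fixes T :: "real \<Rightarrow> 'h::banach \<Rightarrow> 'h"
  assumes T: "C0_semigroup T"
  shows "\<exists>M\<ge>1. \<forall>s\<in>{0..t}. \<forall>x. norm (T s x) \<le> M * norm x"
proof -
  have lin: "\<And>s. s \<ge> 0 \<Longrightarrow> bounded_linear (T s)"
    and T_add: "\<And>s u x. s \<ge> 0 \<Longrightarrow> u \<ge> 0 \<Longrightarrow> T (s + u) x = T s (T u x)"
    and T0: "T 0 = id"
    and cont: "\<And>x. ((\<lambda>t. T t x) \<longlongrightarrow> x) (at_right 0)"
    using T by (auto simp: C0_semigroup_def)
  \<comment> \<open>One \<open>n\<close> serves both as bound and as inverse interval length, so the
    negation yields times tending to 0 along which the operators are not uniformly bounded.\<close>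
  have "\<exists>n::nat. \<forall>s x. 0 < s \<longrightarrow> s \<le> 1 / Suc n \<longrightarrow> norm (T s x) \<le> n * norm x"
  proof (rule ccontr)
    assume "\<not> ?thesis"
    then have "\<forall>n::nat. \<exists>s x. 0 < s \<and> s \<le> 1 / Suc n \<and> norm (T s x) > n * norm x"
      by (simp add: not_le)
    then obtain s y where s: "\<And>n::nat. 0 < s n" "\<And>n. s n \<le> 1 / Suc n"
      and y: "\<And>n. norm (T (s n) (y n)) > n * norm (y n)" by metis
    have "s \<longlonglongrightarrow> 0"
      by (rule tendsto_sandwich[OF _ _ tendsto_const LIMSEQ_inverse_real_of_nat])
        (use s in \<open>auto intro!: always_eventually simp: less_imp_le inverse_eq_divide\<close>)
    then have s0: "filterlim s (at_right 0) sequentially"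
      using s(1) less_imp_neq[OF s(1)] by (auto simp: filterlim_at intro!: always_eventually)
    have "\<exists>M. \<forall>f\<in>range (\<lambda>n. T (s n)). \<forall>x. norm (f x) \<le> M * norm x"
    proof (rule uniform_boundedness)
      fix x
      have "(\<lambda>n. T (s n) x) \<longlonglongrightarrow> x"
        by (rule filterlim_compose[OF cont s0])
      then have "bounded (range (\<lambda>n. T (s n) x))"
        by (rule convergent_imp_bounded)
      then show "bounded ((\<lambda>f. f x) ` range (\<lambda>n. T (s n)))" by (simp add: image_image)
    qed (use lin s in \<open>auto simp: less_imp_le\<close>)
    then obtain M where M: "\<And>n x. norm (T (s n) x) \<le> M * norm x" by auto
    obtain n where "M \<le> real n" using real_arch_simple by blast
    then have "norm (T (s n) (y n)) \<le> n * norm (y n)"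
      using M[of n "y n"] by (meson mult_right_mono norm_ge_zero order_trans)
    then show False using y[of n] by simp
  qed
  then obtain n :: nat where n: "\<And>s x. 0 < s \<Longrightarrow> s \<le> 1 / Suc n \<Longrightarrow> norm (T s x) \<le> n * norm x"
    by blast
  define d where "d = 1 / real (Suc n)"
  \<comment> \<open>Adding 1 covers \<open>T 0 = id\<close> and makes the powers of \<open>M\<close>
    increasing.\<close>
  define M where "M = real n + 1"
  have M1: "M \<ge> 1" and d: "d > 0" by (auto simp: M_def d_def)
  have M: "norm (T s x) \<le> M * norm x" if "0 \<le> s" "s \<le> d" for s x
  proof (cases "s = 0")
    case True
    then show ?thesis using T0 by (simp add: M_def algebra_simps)
  next
    case False
    then show ?thesis using n[of s x] that by (simp add: M_def d_def algebra_simps add_increasing)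
  qed
  have pow: "norm (T s x) \<le> M ^ Suc k * norm x" if "0 \<le> s" "s \<le> Suc k * d" for s k x
    using that
  proof (induction k arbitrary: s)
    case (Suc k)
    show ?case
    proof (cases "s \<le> d")
      case True
      have "norm (T s x) \<le> M ^ 1 * norm x" using M True Suc.prems by simp
      also have "\<dots> \<le> M ^ Suc (Suc k) * norm x"
        using M1 by (intro mult_right_mono power_increasing) auto
      finally show ?thesis .
    next
      case False
      have "norm (T s x) = norm (T d (T (s - d) x))"
        using T_add[of d "s - d" x] d False by simp
      also have "\<dots> \<le> M * norm (T (s - d) x)" using M d by simp
      also have "\<dots> \<le> M * (M ^ Suc k * norm x)"
        using Suc.IH[of "s - d"] Suc.prems False M1 by (intro mult_left_mono) (auto simp: algebra_simps)
      finally show ?thesis by (simp add: mult.assoc)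
    qed
  qed (use M in simp)
  obtain k :: nat where k: "t / d \<le> k" using real_arch_simple by blast
  then have "t \<le> Suc k * d" using d by (simp add: field_simps)
  then have "norm (T s x) \<le> M ^ Suc k * norm x" if "s \<in> {0..t}" for s x
    using pow[of s k x] that by auto
  then show ?thesis using one_le_power[OF M1, of "Suc k"] by blast
qed

section \<open>Symmetry of the heat semigroup and difference quotients of the form\<close>

text \<open>\<open>T s\<close> is continuous and commutes with the difference quotients at 0, so it
  maps the limit for \<open>f\<close> to the limit for \<open>T s f\<close>.\<close>

lemma heat_semigroup_domain:
  fixes T :: "real \<Rightarrow> 'h::real_normed_vector \<Rightarrow> 'h"
  assumes T: "heat_semigroup D A T" and f: "f \<in> D" and s: "s \<ge> 0"
  shows "T s f \<in> D" "A (T s f) = T s (A f)"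
proof -
  have sg: "C0_semigroup T" and gen: "((\<lambda>t. (T t f - f) /\<^sub>R t) \<longlongrightarrow> g) (at_right 0) \<longleftrightarrow> f \<in> D \<and> g = - A f" for f g
    using T by (auto simp: heat_semigroup_def)
  interpret bounded_linear "T s" using sg s by (simp add: C0_semigroup_def)
  have "((\<lambda>t. T s ((T t f - f) /\<^sub>R t)) \<longlongrightarrow> T s (- A f)) (at_right 0)"
    by (rule tendsto) (use gen f in simp)
  moreover have "\<forall>\<^sub>F t in at_right 0. T s ((T t f - f) /\<^sub>R t) = (T t (T s f) - T s f) /\<^sub>R t"
  proof (rule eventually_at_rightI[of 0 1])
    fix t :: real assume "t \<in> {0<..<1}"
    then have "T t (T s f) = T (t + s) f" "T s (T t f) = T (s + t) f"
      using sg s by (auto simp: C0_semigroup_def)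
    then show "T s ((T t f - f) /\<^sub>R t) = (T t (T s f) - T s f) /\<^sub>R t"
      by (simp add: scaleR diff add.commute)
  qed simp
  ultimately have "((\<lambda>t. (T t (T s f) - T s f) /\<^sub>R t) \<longlongrightarrow> - T s (A f)) (at_right 0)"
    unfolding linear_neg[OF linear] by (rule Lim_transform_eventually)
  then show "T s f \<in> D" "A (T s f) = T s (A f)" using gen by auto
qed

text \<open>Moving one time step \<open>h\<close> from one factor of the inner product to the other
  costs o(h), uniformly along the orbit, because the first-order terms cancel by symmetry of
  \<open>A\<close>. The \<open>t / h\<close> steps together cost \<open>t\<close> times a quantity
  tending to 0.\<close>

lemma heat_semigroup_symmetric:
  fixes T :: "real \<Rightarrow> 'h::{real_inner, banach} \<Rightarrow> 'h"
  assumes T: "heat_semigroup D A T" and A: "self_adjoint D A"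
    and f: "f \<in> D" and g: "g \<in> D" and t: "t \<ge> 0"
  shows "inner (T t f) g = inner f (T t g)"
proof -
  have sg: "C0_semigroup T" using T by (simp add: heat_semigroup_def)
  then have lin: "\<And>s. s \<ge> 0 \<Longrightarrow> bounded_linear (T s)"
    and T_add: "\<And>s u x. s \<ge> 0 \<Longrightarrow> u \<ge> 0 \<Longrightarrow> T (s + u) x = T s (T u x)"
    and T0: "T 0 = id"
    by (auto simp: C0_semigroup_def)
  obtain M where M1: "M \<ge> 1" and M: "\<And>s x. 0 \<le> s \<Longrightarrow> s \<le> t \<Longrightarrow> norm (T s x) \<le> M * norm x"
    using C0_semigroup_locally_bounded[OF sg, of t] by auto
  define \<eta> where "\<eta> x h = norm ((T h x - x) /\<^sub>R h + A x)" for x h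
  have \<eta>_nonneg: "\<eta> x h \<ge> 0" for x h by (simp add: \<eta>_def)
  have \<eta>0: "(\<eta> x \<longlongrightarrow> 0) (at_right 0)" if "x \<in> D" for x
  proof -
    have "((\<lambda>h. (T h x - x) /\<^sub>R h) \<longlongrightarrow> - A x) (at_right 0)"
      using T that by (simp add: heat_semigroup_def)
    then have "((\<lambda>h. (T h x - x) /\<^sub>R h + A x) \<longlongrightarrow> - A x + A x) (at_right 0)"
      by (intro tendsto_intros)
    then show ?thesis unfolding \<eta>_def by (simp add: tendsto_norm_zero)
  qed
  \<comment> \<open>The expansion error at \<open>T s x\<close> is \<open>T s\<close> applied to the
    error at \<open>x\<close>; this makes the estimate uniform in \<open>s\<close>.\<close>
  have remainder: "norm (T h (T s x) - T s x + h *\<^sub>R A (T s x)) \<le> M * (h * \<eta> x h)"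
    if "x \<in> D" "0 < h" "0 \<le> s" "s \<le> t" for x h s
  proof -
    interpret bounded_linear "T s" using lin that by simp
    have "T h (T s x) = T s (T h x)"
      using that by (simp flip: T_add add: Groups.add.commute)
    then have "T h (T s x) - T s x + h *\<^sub>R A (T s x) = T s (h *\<^sub>R ((T h x - x) /\<^sub>R h + A x))"
      using that by (simp add: heat_semigroup_domain(2)[OF T] diff scaleR add scaleR_add_right)
    then show ?thesis
      using M[of s "h *\<^sub>R ((T h x - x) /\<^sub>R h + A x)"] that by (simp add: \<eta>_def)
  qed
  have step: "\<bar>inner (T h a) b - inner a (T h b)\<bar>
      \<le> M * (h * \<eta> f h) * (M * norm g) + M * norm f * (M * (h * \<eta> g h))"
    if "a = T s f" "b = T u g" "0 < h" "0 \<le> s" "s \<le> t" "0 \<le> u" "u \<le> t" for a b h s u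
  proof -
    have D: "a \<in> D" "b \<in> D" using that heat_semigroup_domain(1)[OF T] f g by auto
    then have "inner (A a) b = inner a (A b)" using A by (simp add: self_adjoint_def)
    then have "inner (T h a) b - inner a (T h b)
        = inner (T h a - a + h *\<^sub>R A a) b - inner a (T h b - b + h *\<^sub>R A b)"
      by (simp add: inner_diff_left inner_diff_right inner_add_left inner_add_right)
    also have "\<bar>\<dots>\<bar> \<le> norm (T h a - a + h *\<^sub>R A a) * norm b + norm a * norm (T h b - b + h *\<^sub>R A b)"
      by (intro order_trans[OF abs_triangle_ineq4] add_mono Cauchy_Schwarz_ineq2)
    also have "\<dots> \<le> M * (h * \<eta> f h) * (M * norm g) + M * norm f * (M * (h * \<eta> g h))"
      using that M1 f g
      by (auto intro!: add_mono mult_mono remainder M simp: \<eta>_nonneg)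
    finally show ?thesis .
  qed
  show ?thesis
  proof (cases "t = 0")
    case False
    with t have t0: "t > 0" by simp
    have bound: "\<bar>inner (T t f) g - inner f (T t g)\<bar>
        \<le> t * (M * \<eta> f (t / Suc n) * (M * norm g) + M * norm f * (M * \<eta> g (t / Suc n)))" for n
    proof -
      define h where "h = t / Suc n"
      have h: "h > 0" "Suc n * h = t" using t0 by (auto simp: h_def)
      \<comment> \<open>\<open>F (Suc n)\<close> and \<open>F 0\<close> are the two sides of the
        claimed identity, so their difference telescopes.\<close>
      define F where "F k = inner (T (k * h) f) (T ((Suc n - k) * h) g)" for k :: nat
      have "F (Suc n) - F 0 = (\<Sum>k<Suc n. F (Suc k) - F k)"
        by (simp only: sum_lessThan_telescope)
      also have "\<bar>\<dots>\<bar> \<le> (\<Sum>k<Suc n. \<bar>F (Suc k) - F k\<bar>)" by (rule sum_abs)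
      also have "\<dots> \<le> (\<Sum>k<Suc n. M * (h * \<eta> f h) * (M * norm g) + M * norm f * (M * (h * \<eta> g h)))"
      proof (rule sum_mono)
        fix k assume "k \<in> {..<Suc n}"
        then have k: "k \<le> n" by simp
        have mono: "real i * h \<le> t" if "i \<le> Suc n" for i
          using that h mult_right_mono[of "real i" "real (Suc n)" h] by simp
        have "T (Suc k * h) f = T h (T (k * h) f)"
          using T_add[of h "k * h" f] h by (simp add: algebra_simps)
        moreover have "T ((Suc n - k) * h) g = T h (T ((n - k) * h) g)"
          using T_add[of h "(n - k) * h" g] h k by (simp add: algebra_simps of_nat_diff)
        ultimately have "F (Suc k) - F k = inner (T h (T (k * h) f)) (T ((n - k) * h) g)
            - inner (T (k * h) f) (T h (T ((n - k) * h) g))"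
          by (simp add: F_def)
        then show "\<bar>F (Suc k) - F k\<bar> \<le> M * (h * \<eta> f h) * (M * norm g) + M * norm f * (M * (h * \<eta> g h))"
          using step[OF refl refl, of h "k * h" "(n - k) * h"] h k mono[of k] mono[of "n - k"] by simp
      qed
      also have "\<dots> = Suc n * h * (M * \<eta> f h * (M * norm g) + M * norm f * (M * \<eta> g h))"
        by (simp add: algebra_simps)
      finally show ?thesis using T0 h(2) unfolding h_def[symmetric] by (simp add: F_def)
    qed
    have "filterlim (\<lambda>n. t / Suc n) (at_right 0) sequentially"
      using tendsto_mult[OF tendsto_const[of t] LIMSEQ_inverse_real_of_nat] t0
      by (auto simp: filterlim_at divide_inverse intro!: always_eventually)
    then have "(\<lambda>n. \<eta> x (t / Suc n)) \<longlonglongrightarrow> 0" if "x \<in> D" for x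
      using filterlim_compose[OF \<eta>0[OF that]] by blast
    from this[OF f] this[OF g]
    have "(\<lambda>n. t * (M * \<eta> f (t / Suc n) * (M * norm g) + M * norm f * (M * \<eta> g (t / Suc n))))
        \<longlonglongrightarrow> t * (M * 0 * (M * norm g) + M * norm f * (M * 0))"
      by (intro tendsto_intros)
    then have "\<bar>inner (T t f) g - inner f (T t g)\<bar> \<le> t * (M * 0 * (M * norm g) + M * norm f * (M * 0))"
      by (rule LIMSEQ_le_const) (use bound in blast)
    then show ?thesis by simp
  qed (simp add: T0)
qed

lemma heat_semigroup_difference_quotient_le:
  fixes T :: "real \<Rightarrow> 'h::{real_inner, banach} \<Rightarrow> 'h"
  assumes T: "heat_semigroup D A T" and A: "self_adjoint D A" and f: "f \<in> D" and t: "t > 0"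
  shows "inner (f - T t f) f \<le> t * inner (A f) f"
proof -
  define \<phi> where "\<phi> s = inner (f - T s f) f / s" for s
  have sg: "C0_semigroup T" using T by (simp add: heat_semigroup_def)
  have half: "\<phi> s \<le> \<phi> (s / 2)" if s: "s > 0" for s
  proof -
    have "T s f = T (s / 2) (T (s / 2) f)"
    proof -
      have "T (s / 2 + s / 2) = T (s / 2) \<circ> T (s / 2)"
        using sg s unfolding C0_semigroup_def by (meson half_gt_zero less_imp_le)
      then show ?thesis by (simp add: fun_eq_iff)
    qed
    \<comment> \<open>Symmetry is available for vectors of \<open>D\<close>, hence the appeal to the
      invariance of \<open>D\<close> for \<open>T (s / 2) f\<close>.\<close>
    moreover have "inner (T (s / 2) (T (s / 2) f)) f = inner (T (s / 2) f) (T (s / 2) f)"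
      using s by (intro heat_semigroup_symmetric[OF T A] heat_semigroup_domain(1)[OF T] f) auto
    moreover have "0 \<le> inner (f - T (s / 2) f) (f - T (s / 2) f)" by simp
    ultimately have "inner (f - T s f) f \<le> 2 * inner (f - T (s / 2) f) f"
      by (simp add: inner_diff_left inner_diff_right inner_commute)
    then show ?thesis using s by (simp add: \<phi>_def field_simps)
  qed
  have le: "\<phi> t \<le> \<phi> (t / 2 ^ n)" for n
  proof (induction n)
    case (Suc n)
    then show ?case using half[of "t / 2 ^ n"] t by (simp add: mult.commute)
  qed simp
  have "(\<lambda>n. t * (1/2) ^ n) \<longlonglongrightarrow> t * 0"
    by (intro tendsto_intros LIMSEQ_power_zero) auto
  then have "filterlim (\<lambda>n. t / 2 ^ n) (at_right 0) sequentially"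
    using t by (auto simp: filterlim_at power_divide intro!: always_eventually)
  moreover have "((\<lambda>s. (T s f - f) /\<^sub>R s) \<longlongrightarrow> - A f) (at_right 0)"
    using T f by (simp add: heat_semigroup_def)
  then have "((\<lambda>s. inner (- ((T s f - f) /\<^sub>R s)) f) \<longlongrightarrow> inner (- (- A f)) f) (at_right 0)"
    by (intro tendsto_intros)
  then have "(\<phi> \<longlongrightarrow> inner (A f) f) (at_right 0)"
    by (simp add: \<phi>_def[abs_def] divide_inverse inner_diff_left algebra_simps)
  ultimately have "(\<lambda>n. \<phi> (t / 2 ^ n)) \<longlonglongrightarrow> inner (A f) f"
    by (rule filterlim_compose[rotated])
  then have "\<phi> t \<le> inner (A f) f"
    by (rule LIMSEQ_le_const) (use le in blast)
  then show ?thesis using t by (simp add: \<phi>_def field_simps)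
qed

text \<open>Both sides pass to the limit along a sequence in \<open>D\<close> approximating
  \<open>v\<close> in the form sense: the left by continuity of \<open>T t\<close>, the right by the
  construction of the form.\<close>

lemma dirichlet_form_ge_difference_quotient:
  fixes T :: "real \<Rightarrow> 'h::{real_inner, banach} \<Rightarrow> 'h"
  assumes T: "heat_semigroup D A T" and A: "self_adjoint D A" and pos: "positive_operator D A"
    and v: "v \<in> form_domain D A" and t: "t > 0"
  shows "inner (v - T t v) v \<le> t * dirichlet_form D A v v"
proof -
  obtain u where u: "form_approx D A u v" using v by (auto simp: form_domain_def)
  have uv: "u \<longlonglongrightarrow> v" and uD: "\<And>n. u n \<in> D" using u by (auto simp: form_approx_def)
  interpret bounded_linear "T t"
    using T t by (auto simp: heat_semigroup_def C0_semigroup_def)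
  have "(\<lambda>n. inner (u n - T t (u n)) (u n)) \<longlonglongrightarrow> inner (v - T t v) v"
    by (intro tendsto_intros tendsto uv)
  moreover have "(\<lambda>n. t * inner (A (u n)) (u n)) \<longlonglongrightarrow> t * dirichlet_form D A v v"
    by (intro tendsto_intros dirichlet_form_tendsto[OF A pos u u])
  ultimately show ?thesis
    by (rule LIMSEQ_le) (use heat_semigroup_difference_quotient_le[OF T A uD t] in blast)
qed

section \<open>Hoelder's inequality\<close>

text \<open>For \<open>q = 1\<close> the essential supremum is pulled out of the integral. Otherwise
  Young's inequality is integrated after dividing both functions by their norms.\<close>

lemma Holder_Lp_norm_fun:
  fixes f g :: "'a::euclidean_space \<Rightarrow> real"
  assumes [measurable]: "f \<in> borel_measurable lebesgue" "g \<in> borel_measurable lebesgue"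
    and q: "1 \<le> q" and p: "p = (if q = 1 then \<infinity> else ennreal (q / (q - 1)))"
  shows "(\<integral>\<^sup>+x. ennreal \<bar>f x * g x\<bar> \<partial>lebesgue) \<le> Lp_norm_fun p f * Lp_norm_fun (ennreal q) g"
proof (cases "q = 1")
  case True
  have g: "Lp_norm_fun (ennreal q) g = (\<integral>\<^sup>+x. ennreal \<bar>g x\<bar> \<partial>lebesgue)"
    by (cases "\<integral>\<^sup>+x. ennreal \<bar>g x\<bar> \<partial>lebesgue") (auto simp: Lp_norm_fun_def True)
  have "AE x in lebesgue. ennreal \<bar>f x * g x\<bar> \<le> Lp_norm_fun p f * ennreal \<bar>g x\<bar>"
    using esssup_AE[of "\<lambda>x. ennreal \<bar>f x\<bar>" lebesgue]
    by eventually_elim (simp add: Lp_norm_fun_def p True abs_mult ennreal_mult mult_right_mono)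
  then have "(\<integral>\<^sup>+x. ennreal \<bar>f x * g x\<bar> \<partial>lebesgue) \<le> (\<integral>\<^sup>+x. Lp_norm_fun p f * ennreal \<bar>g x\<bar> \<partial>lebesgue)"
    by (rule nn_integral_mono_AE)
  then show ?thesis by (simp add: nn_integral_cmult g)
next
  case False
  define r where "r = q / (q - 1)"
  have q1: "q > 1" and r1: "r > 1" and rq: "1 / r + 1 / q = 1"
    using q False by (auto simp: r_def field_simps)
  define F where "F = (\<integral>\<^sup>+x. ennreal (\<bar>f x\<bar> powr r) \<partial>lebesgue)"
  define G where "G = (\<integral>\<^sup>+x. ennreal (\<bar>g x\<bar> powr q) \<partial>lebesgue)"
  have norms: "Lp_norm_fun p f = (if F = \<infinity> then \<infinity> else ennreal (enn2real F powr (1 / r)))"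
    "Lp_norm_fun (ennreal q) g = (if G = \<infinity> then \<infinity> else ennreal (enn2real G powr (1 / q)))"
    using q1 r1 False by (auto simp: Lp_norm_fun_def p r_def F_def G_def Let_def)
  \<comment> \<open>The vanishing case comes first because the product of 0 and infinity is 0 in
    \<open>ennreal\<close>; in the two infinite cases the other factor is then nonzero and the
    right-hand side is infinite.\<close>
  consider "F = 0 \<or> G = 0" | "F = \<infinity>" "G \<noteq> 0" | "G = \<infinity>" "F \<noteq> 0"
    | a b where "F = ennreal a" "G = ennreal b" "a > 0" "b > 0"
    by (cases F; cases G) (auto simp: less_le)
  then show ?thesis
  proof cases
    case 1
    then have "AE x in lebesgue. f x * g x = 0"
    proof
      assume "F = 0"
      then have "AE x in lebesgue. ennreal (\<bar>f x\<bar> powr r) = 0"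
        unfolding F_def by (subst (asm) nn_integral_0_iff_AE) auto
      then show ?thesis by eventually_elim simp
    next
      assume "G = 0"
      then have "AE x in lebesgue. ennreal (\<bar>g x\<bar> powr q) = 0"
        unfolding G_def by (subst (asm) nn_integral_0_iff_AE) auto
      then show ?thesis by eventually_elim simp
    qed
    then have "(\<integral>\<^sup>+x. ennreal \<bar>f x * g x\<bar> \<partial>lebesgue) = 0"
      by (subst nn_integral_0_iff_AE) (auto elim: eventually_mono)
    then show ?thesis by simp
  next
    case 2
    then show ?thesis by (cases G) (auto simp: norms ennreal_top_mult)
  next
    case 3
    then show ?thesis by (cases F) (auto simp: norms ennreal_mult_top)
  next
    case (4 a b)
    \<comment> \<open>These are the two norms. The coefficients in \<open>young\<close> are chosen
      so that integration leaves \<alpha> \<beta> (1/r + 1/q) = \<alpha> \<beta>.\<close>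
    define \<alpha> \<beta> where "\<alpha> = a powr (1 / r)" and "\<beta> = b powr (1 / q)"
    have \<alpha>\<beta>: "\<alpha> > 0" "\<beta> > 0" "\<alpha> powr r = a" "\<beta> powr q = b"
      using 4 q1 r1 by (auto simp: \<alpha>_def \<beta>_def powr_powr)
    have young: "\<bar>f x * g x\<bar> \<le> \<alpha> * \<beta> / (r * a) * \<bar>f x\<bar> powr r + \<alpha> * \<beta> / (q * b) * \<bar>g x\<bar> powr q" for x
    proof -
      have "(\<bar>f x\<bar> / \<alpha>) * (\<bar>g x\<bar> / \<beta>) \<le> (\<bar>f x\<bar> / \<alpha>) powr r / r + (\<bar>g x\<bar> / \<beta>) powr q / q"
        using r1 q1 rq \<alpha>\<beta> by (intro Youngs_inequality) auto
      then have "\<bar>f x\<bar> * \<bar>g x\<bar> \<le> \<alpha> * \<beta> * (\<bar>f x\<bar> powr r / a / r + \<bar>g x\<bar> powr q / b / q)"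
        using \<alpha>\<beta> by (simp add: powr_divide field_simps)
      then show ?thesis by (simp add: abs_mult distrib_left mult_ac)
    qed
    have "(\<integral>\<^sup>+x. ennreal \<bar>f x * g x\<bar> \<partial>lebesgue)
        \<le> (\<integral>\<^sup>+x. ennreal (\<alpha> * \<beta> / (r * a)) * ennreal (\<bar>f x\<bar> powr r)
             + ennreal (\<alpha> * \<beta> / (q * b)) * ennreal (\<bar>g x\<bar> powr q) \<partial>lebesgue)"
      using young \<alpha>\<beta>(1,2) 4 q1 r1
      by (intro nn_integral_mono) (simp flip: ennreal_mult ennreal_plus add: ennreal_leI)
    also have "\<dots> = ennreal (\<alpha> * \<beta> / (r * a)) * F + ennreal (\<alpha> * \<beta> / (q * b)) * G"
      by (simp add: nn_integral_add nn_integral_cmult F_def G_def)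
    also have "\<dots> = ennreal (\<alpha> * \<beta> * (1 / r + 1 / q))"
      using \<alpha>\<beta>(1,2) 4 q1 r1
      by (simp flip: ennreal_mult ennreal_plus) (simp add: field_simps)
    also have "\<dots> = Lp_norm_fun p f * Lp_norm_fun (ennreal q) g"
      using 4 \<alpha>\<beta>(1,2) by (simp add: rq norms \<alpha>_def \<beta>_def ennreal_mult)
    finally show ?thesis .
  qed
qed

text \<open>Since \<open>ennreal\<close> sends negative reals to 0, this is a one-sided estimate; an
  upper bound for the inner product is what the theorem requires.\<close>

lemma inner_L2_le_Lp_norm:
  assumes q: "1 \<le> q" and p: "p = (if q = 1 then \<infinity> else ennreal (q / (q - 1)))"
  shows "ennreal (inner f g) \<le> Lp_norm p f * Lp_norm (ennreal q) g"
proof (transfer fixing: q p, goal_cases)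
  case (1 f g)
  then have [measurable]: "f \<in> borel_measurable lebesgue" "g \<in> borel_measurable lebesgue"
    and int: "integrable lebesgue (\<lambda>x. f x * g x)"
    by (auto simp: L2_rel_def intro: integrable_mult_L2)
  have "ennreal (LINT x|lebesgue. f x * g x) \<le> ennreal (LINT x|lebesgue. \<bar>f x * g x\<bar>)"
    by (intro ennreal_leI integral_mono int integrable_abs) auto
  also have "\<dots> = (\<integral>\<^sup>+x. ennreal \<bar>f x * g x\<bar> \<partial>lebesgue)"
    by (intro nn_integral_eq_integral[symmetric] integrable_abs int) auto
  also have "\<dots> \<le> Lp_norm_fun p f * Lp_norm_fun (ennreal q) g"
    by (intro Holder_Lp_norm_fun q p) measurable
  finally show ?case .
qed

section \<open>Choice of the time and conclusion\<close>

lemma optimal_time: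
  fixes C \<nu> N b \<tau> :: real
  assumes "C > 0" "\<nu> > 0" "N > 0" "b > 0" "\<tau> > 0"
  shows "\<exists>t>\<tau>. C * t powr (- \<nu>) * b\<^sup>2 \<le> N\<^sup>2 / 2 \<and>
    min (1 / 2) ((2 * C) powr (- 1 / \<nu>)) * min (1 / \<tau>) ((N / b) powr (2 / \<nu>)) \<le> 1 / t"
proof -
  \<comment> \<open>\<open>s\<close> solves \<open>C * s powr (- \<nu>) * b^2 = N^2 / 2\<close>. In
    \<open>t\<close>, the factor 2 before \<tau> ensures \<open>t > \<tau>\<close> strictly and is
    the origin of the 1/2 in the constant.\<close>
  define s where "s = (2 * C * (b / N)\<^sup>2) powr (1 / \<nu>)"
  define t where "t = max (2 * \<tau>) s"
  have s: "s > 0" "s powr (- \<nu>) = 1 / (2 * C * (b / N)\<^sup>2)"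
    using assms by (auto simp: s_def powr_powr powr_minus_divide)
  have "1 / s = (2 * C) powr (- 1 / \<nu>) * (N / b) powr (2 / \<nu>)"
  proof -
    have "s = (2 * C) powr (1 / \<nu>) * ((b / N) powr 2) powr (1 / \<nu>)"
      using assms by (simp add: s_def powr_mult)
    also have "\<dots> = (2 * C) powr (1 / \<nu>) * (b / N) powr (2 / \<nu>)"
      by (simp only: powr_powr) simp
    finally show ?thesis using assms by (simp add: powr_minus_divide powr_divide)
  qed
  moreover have "1 / t = min (1 / 2 * (1 / \<tau>)) (1 / s)"
    using assms s by (auto simp: t_def min_def max_def field_simps)
  \<comment> \<open>Splitting the minimum of products separates the constant, which involves only
    \<open>C\<close> and \<nu>, from the minimum appearing in the theorem.\<close>
  moreover have "min x y * min z w \<le> min (x * z) (y * w)" if "x \<ge> 0" "y \<ge> 0" "z \<ge> 0" "w \<ge> 0" for x y z w :: real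
    using that by (auto intro!: mult_mono)
  from this[of "1 / 2" "(2 * C) powr (- 1 / \<nu>)" "1 / \<tau>" "(N / b) powr (2 / \<nu>)"]
  have "min (1 / 2) ((2 * C) powr (- 1 / \<nu>)) * min (1 / \<tau>) ((N / b) powr (2 / \<nu>))
      \<le> min (1 / 2 * (1 / \<tau>)) ((2 * C) powr (- 1 / \<nu>) * (N / b) powr (2 / \<nu>))"
    using assms by simp
  ultimately have "min (1 / 2) ((2 * C) powr (- 1 / \<nu>)) * min (1 / \<tau>) ((N / b) powr (2 / \<nu>)) \<le> 1 / t"
    by simp
  moreover have "C * t powr (- \<nu>) * b\<^sup>2 \<le> C * s powr (- \<nu>) * b\<^sup>2"
    using assms s(1) by (intro mult_right_mono mult_left_mono powr_mono2') (auto simp: t_def)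
  then have "C * t powr (- \<nu>) * b\<^sup>2 \<le> N\<^sup>2 / 2"
    using assms by (simp add: s(2) field_simps)
  moreover have "t > \<tau>" using assms by (simp add: t_def)
  ultimately show ?thesis by blast
qed

theorem theorem3p4:
  fixes C2 \<nu> :: real
  assumes "C2 > 0" and "\<nu> > 0"
  shows "\<exists>C>0. \<forall>(D :: (real ^ 'n) L2 set) A T (q::real) (p::ennreal) (\<tau>::real) v.
    self_adjoint D A \<longrightarrow> positive_operator D A \<longrightarrow>
    heat_semigroup D A T \<longrightarrow> submarkovian T \<longrightarrow>
    1 \<le> q \<longrightarrow> q < 2 \<longrightarrow> p = (if q = 1 then \<infinity> else ennreal (q / (q - 1))) \<longrightarrow> \<tau> > 0 \<longrightarrow>
    v \<in> form_domain D A \<longrightarrow> Lp_norm 1 v < \<infinity> \<longrightarrow> Lp_norm p v < \<infinity> \<longrightarrow>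
    (\<forall>t>\<tau>. Lp_norm p (T t v) \<le> ennreal (C2 * t powr (- \<nu>)) * Lp_norm (ennreal q) v) \<longrightarrow>
    dirichlet_form D A v v \<ge>
      C * (norm v)\<^sup>2 * min (1 / \<tau>) ((norm v / enn2real (Lp_norm (ennreal q) v)) powr (2 / \<nu>))"
proof -
  \<comment> \<open>Half the constant of \<open>optimal_time\<close>: the other 1/2 is lost in
    \<open>N^2 / 2\<close>, the part of the squared norm that survives after subtracting the decay
    bound. It depends on \<open>C2\<close> and \<nu> alone.\<close>
  define C where "C = min (1 / 2) ((2 * C2) powr (- 1 / \<nu>)) / 2"
  have "C > 0" using assms by (simp add: C_def)
  moreover have "C * (norm v)\<^sup>2 * min (1 / \<tau>) ((norm v / enn2real (Lp_norm (ennreal q) v)) powr (2 / \<nu>))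
      \<le> dirichlet_form D A v v"
    if A: "self_adjoint D A" "positive_operator D A" and T: "heat_semigroup D A T"
      and q: "1 \<le> q" and p: "p = (if q = 1 then \<infinity> else ennreal (q / (q - 1)))"
      and \<tau>: "\<tau> > 0" and v: "v \<in> form_domain D A"
      and bound: "\<forall>t>\<tau>. Lp_norm p (T t v) \<le> ennreal (C2 * t powr (- \<nu>)) * Lp_norm (ennreal q) v"
    for D :: "(real ^ 'n) L2 set" and A T q p \<tau> v
  proof -
    define N b where "N = norm v" and "b = enn2real (Lp_norm (ennreal q) v)"
    have form_ge: "inner (v - T t v) v \<le> t * dirichlet_form D A v v" if "t > 0" for t
      using that by (rule dirichlet_form_ge_difference_quotient[OF T A v])
    show ?thesis
    proof (cases "N = 0 \<or> b = 0")
      case True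
      \<comment> \<open>This covers $v \notin L^q$, where \<^const>\<open>enn2real\<close> gives \<open>b = 0\<close> and the bound degenerates to 0.\<close>
      have "0 \<le> dirichlet_form D A v v"
      proof -
        obtain u where u: "form_approx D A u v" using v by (auto simp: form_domain_def)
        show ?thesis
          by (rule LIMSEQ_le_const[OF dirichlet_form_tendsto[OF A u u]])
            (use u A(2) in \<open>auto simp: form_approx_def positive_operator_def\<close>)
      qed
      then show ?thesis using True \<tau> by (auto simp: N_def b_def)
    next
      case False
      then have pos: "N > 0" "b > 0" by (auto simp: N_def b_def less_le)
      \<comment> \<open>An infinite norm would give \<open>b = 0\<close>, so positivity of
        \<open>b\<close> makes the norm finite.\<close>
      then have Lq: "Lp_norm (ennreal q) v = ennreal b"
        by (cases "Lp_norm (ennreal q) v") (auto simp: b_def)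
      obtain t where t: "t > \<tau>" "C2 * t powr (- \<nu>) * b\<^sup>2 \<le> N\<^sup>2 / 2"
        "2 * C * min (1 / \<tau>) ((N / b) powr (2 / \<nu>)) \<le> 1 / t"
        using optimal_time[OF assms pos \<tau>] by (auto simp: C_def)
      have "ennreal (inner (T t v) v) \<le> Lp_norm p (T t v) * ennreal b"
        using inner_L2_le_Lp_norm[OF q p, of "T t v" v] Lq by simp
      also have "\<dots> \<le> ennreal (C2 * t powr (- \<nu>)) * ennreal b * ennreal b"
        using bound t(1) Lq by (intro mult_right_mono) auto
      also have "\<dots> = ennreal (C2 * t powr (- \<nu>) * b\<^sup>2)"
        using assms pos by (simp add: power2_eq_square ennreal_mult mult.assoc)
      finally have "inner (T t v) v \<le> C2 * t powr (- \<nu>) * b\<^sup>2"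
        using assms by (subst (asm) ennreal_le_iff) auto
      then have "N\<^sup>2 / 2 \<le> inner (v - T t v) v"
        using t(2) by (simp add: inner_diff_left N_def power2_norm_eq_inner)
      also have "\<dots> \<le> t * dirichlet_form D A v v"
        using form_ge t(1) \<tau> by simp
      finally have "N\<^sup>2 / 2 * (1 / t) \<le> dirichlet_form D A v v"
        using t(1) \<tau> by (simp add: field_simps)
      moreover have "N\<^sup>2 / 2 * (2 * C * min (1 / \<tau>) ((N / b) powr (2 / \<nu>))) \<le> N\<^sup>2 / 2 * (1 / t)"
        by (intro mult_left_mono t(3)) simp
      ultimately show ?thesis by (simp add: N_def b_def mult_ac)
    qed
  qed
  ultimately show ?thesis by (intro exI[of _ C]) blast
qed

end
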